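(* Let $\mathsf{appendL}$ be the list append program, a closed Cedille term of type $\forall A{:}\star.\ \mathsf{List}\cdot A\to\mathsf{List}\cdot A\to\mathsf{List}\cdot A$, let $\mathsf{lengthDistAppend}$ be a proof of $\forall A{:}\star.\Pi xs{:}\mathsf{List}\cdot A.\Pi ys{:}\mathsf{List}\cdot A.\ \mathsf{add}\ (\mathsf{length}\cdot A\ xs)\ (\mathsf{length}\cdot A\ ys)\simeq\mathsf{length}\ (\mathsf{appendL}\cdot A\ xs\ ys)$, and define vector append by reuse, $\mathsf{appendV}:\forall A{:}\star.\forall n{:}\mathsf{Nat}.\ \mathsf{Vec}\cdot A\ n\to\forall m{:}\mathsf{Nat}.\ \mathsf{Vec}\cdot A\ m\to\mathsf{Vec}\cdot A\ (\mathsf{add}\ n\ m)$, as $$\begin{aligned}\mathsf{appendV}=\ &\Lambda A.\Lambda n.\lambda xs.\Lambda m.\lambda ys.\ \rho\ (\mathsf{v2u}\cdot A\ {-}n\ xs).2-\ \rho\ (\mathsf{v2u}\cdot A\ {-}m\ ys).2-\\ &\rho\ (\mathsf{lengthDistAppend}\cdot A\ (\mathsf{v2u}\cdot A\ {-}n\ xs).1\ (\mathsf{v2u}\cdot A\ {-}m\ ys).1)-\\ &(\mathsf{l2v}\cdot A\ (\mathsf{appendL}\cdot A\ (\mathsf{v2u}\cdot A\ {-}n\ xs).1\ (\mathsf{v2u}\cdot A\ {-}m\ ys).1)).\end{aligned}$$ Then the erasure of $\mathsf{appendV}$ is the erasure of $\mathsf{appendL}$: $|\mathsf{appendV}| =_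{\alpha\beta\eta}|\mathsf{appendL}|$.
   Context: **Terms and erasure.** Terms are those of Cedille (type theory $\iota\lambda P2$), a type-annotated Curry-style dependent type theory. $\star$ is the kind of types; $\lambda x.\,t$ and $t\ t'$ are explicit abstraction and application (types $\Pi x{:}T.\,T'$, or $T\to T'$); $\Lambda x.\,t$ is implicit (erased) abstraction over a value or a type (types $\forall x{:}T.\,T'$, or $T\Rightarrow T'$ if non-dependent), with implicit value application $t\ {-}t'$ and type application $t\cdot T$; $[t,t']$, $t.1$, $t.2$ are the introduction and projections of the dependent intersection type $\iota x{:}T.\,T'$; $\beta$ and $\beta\{t\}$ are reflexivity proofs of the heterogeneous equality type $t_1\simeq t_2$; $\rho\ q - t$ is $t$ with its type rewritten by the equality proof $q$; $\varsigma\ q$ is symmetry of $q$. Erasure $|\cdot|$ maps annotated terms to untyped $\lambda$-terms: $|x|=x$, $|\lambda x.t|=\lambda x.|t|$, $|t\ t'|=|t|\ |t'|$, $|\Lambda x.t|=|t|$, $|t\ {-}t'|=|t|$, $|t\cdot T|=|t|$, $|[t,t']|=|t|$, $|t.1|=|t.2|=|t|$, $|\beta\{t\}|=|t|$, $|\beta|=\lambda x.x$, $|\rho\ q - t|=|t|$. Defined constants are unfolded. Erased terms are compared up to $\alpha\beta\eta$-equality. Type information does not affect erasure. **Lists.** $\mathsf{ListC}\cdot A=\forall X{:}\star.\ X\to(A\to X\to X)\to X$; $\mathsf{nilCL}=\Lambda A,X.\lambda c_N,c_C.\,c_N$; $\mathsf{consCL}=\Lambda A.\lambda x,xs.\Lambda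 X.\lambda c_N,c_C.\ c_C\ x\ (xs\cdot X\ c_N\ c_C)$; $\mathsf{ListP}\cdot A\ xsC=\forall X{:}\star.\forall P{:}X\to\star.\forall c_N{:}X.\forall c_C{:}A\to X\to X.\ P\ c_N\to(\forall xs{:}X.\Pi x{:}A.\ P\ xs\to P(c_C\ x\ xs))\to P(xsC\cdot X\ c_N\ c_C)$; $\mathsf{ListR}\cdot A\ xsC=(xsC\cdot(\mathsf{ListC}\cdot A)\ \mathsf{nilCL}\ \mathsf{consCL}\simeq xsC)$; $\mathsf{List}\cdot A=\iota xs{:}(\iota xsC{:}\mathsf{ListC}\cdot A.\ \mathsf{ListP}\cdot A\ xsC).\ \mathsf{ListR}\cdot A\ xs.1$. Helper: $\mathsf{mkList}=\Lambda A.\lambda xs.\Lambda q.\,[xs,\ \rho\ q-\beta\{xs\}]$ of type $\forall A.\Pi xs{:}(\iota xsC{:}\mathsf{ListC}\cdot A.\mathsf{ListP}\cdot A\ xsC).\ \mathsf{ListR}\cdot A\ xs.1\Rightarrow\mathsf{List}\cdot A$. With $\mathsf{nilL},\mathsf{consL}$ the constructors of $\mathsf{List}$, the eliminator $\mathsf{elimList}:\forall A.\Pi xs{:}\mathsf{List}\cdot A.\forall P{:}\mathsf{List}\cdot A\to\star.\ P(\mathsf{nilL}\cdot A)\to(\forall xs{:}\mathsf{List}\cdot A.\Pi x{:}A.\ P\ xs\to P(\mathsf{consL}\cdot A\ x\ xs))\to P\ xs$ is $\Lambda A.\lambda xs.\Lambda P.\ \rho\ (\varsigma\ xs.2)-(xs.1.2\cdot(\mathsf{List}\cdot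 A)\cdot P\ {-}(\mathsf{nilL}\cdot A)\ {-}(\mathsf{consL}\cdot A))$. $\mathsf{length}:\forall A{:}\star.\mathsf{List}\cdot A\to\mathsf{Nat}$ is the usual length function. **Vectors.** $\mathsf{Nat}$ is the type of naturals with $\mathsf{zero},\mathsf{suc}$ and addition $\mathsf{add}$. $\mathsf{VecC}\cdot A\ n=\forall X{:}\mathsf{Nat}\to\star.\ X\ \mathsf{zero}\to(\forall n{:}\mathsf{Nat}.\ A\to X\ n\to X(\mathsf{suc}\ n))\to X\ n$; $\mathsf{nilCV}=\Lambda A,X.\lambda c_N,c_C.\,c_N$; $\mathsf{consCV}=\Lambda A,n.\lambda x,xs.\Lambda X.\lambda c_N,c_C.\ c_C\ {-}n\ x\ (xs\cdot X\ c_N\ c_C)$; $\mathsf{VecP}\cdot A\ n\ xsC=\forall X{:}\mathsf{Nat}\to\star.\forall P{:}\Pi n{:}\mathsf{Nat}.X\ n\to\star.\forall c_N{:}X\ \mathsf{zero}.\forall c_C{:}(\forall n{:}\mathsf{Nat}.A\to X\ n\to X(\mathsf{suc}\ n)).\ P\ \mathsf{zero}\ c_N\to(\forall n{:}\mathsf{Nat}.\forall xs{:}X\ n.\Pi x{:}A.\ P\ n\ xs\to P(\mathsf{suc}\ n)(c_C\ {-}n\ x\ xs))\to P\ n\ (xsC\cdot X\ c_N\ c_C)$; $\mathsf{VecR}\cdot A\ n\ xsC=(xsC\cdot(\mathsf{VecC}\cdot A)\ \mathsf{nilCV}\ \mathsf{consCV}\simeq xsC)$; $\mathsf{Vec}\cdot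 A\ n=\iota xs{:}(\iota xsC{:}\mathsf{VecC}\cdot A\ n.\ \mathsf{VecP}\cdot A\ n\ xsC).\ \mathsf{VecR}\cdot A\ n\ xs.1$. Helper: $\mathsf{mkVec}=\Lambda A.\Lambda n.\lambda xs.\Lambda q.\,[xs,\ \rho\ q-\beta\{xs\}]$ of type $\forall A.\forall n.\Pi xs{:}(\iota xsC{:}\mathsf{VecC}\cdot A\ n.\mathsf{VecP}\cdot A\ n\ xsC).\ \mathsf{VecR}\cdot A\ n\ xs.1\Rightarrow\mathsf{Vec}\cdot A\ n$. **Coercion $\mathsf{v2l}$** of type $\forall A.\forall n.\ \mathsf{Vec}\cdot A\ n\to\mathsf{List}\cdot A$. $\mathsf{v2lC}=\Lambda A.\Lambda n.\lambda xs.\Lambda X.\lambda c_N.\lambda c_C.\ xs.1.1\cdot(\lambda\_{:}\mathsf{Nat}.X)\ c_N\ (\Lambda\_.\,c_C)$; $\mathsf{v2lP}=\Lambda A.\Lambda n.\lambda xs.\Lambda X.\Lambda P.\Lambda c_N.\Lambda c_C.\lambda p_N.\lambda p_C.\ xs.1.2\cdot(\lambda\_{:}\mathsf{Nat}.X)\cdot(\lambda\_{:}\mathsf{Nat}.P)\ {-}c_N\ {-}(\Lambda\_.\,c_C)\ p_N\ (\Lambda\_.\,p_C)$; $\mathsf{v2lR}=\Lambda A.\Lambda n.\lambda xs.\ xs.2$; $\mathsf{v2l}=\Lambda A.\Lambda n.\lambda xs.\ \mathsf{mkList}\cdot A\ [\mathsf{v2lC}\cdot A\ {-}n\ xs,\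 \mathsf{v2lP}\cdot A\ {-}n\ xs]\ {-}(\mathsf{v2lR}\cdot A\ {-}n\ xs)$. **Coercion $\mathsf{l2v}$** of type $\forall A.\Pi xs{:}\mathsf{List}\cdot A.\ \mathsf{Vec}\cdot A\ (\mathsf{length}\cdot A\ xs)$. $\mathsf{l2vC}=\Lambda A.\lambda xs.\Lambda X.\lambda c_N.\lambda c_C.\ \mathsf{elimList}\cdot A\ xs\cdot(\lambda xs{:}\mathsf{List}\cdot A.\ X(\mathsf{length}\cdot A\ xs))\ c_N\ (\Lambda xs.\ c_C\ {-}(\mathsf{length}\cdot A\ xs))$; $\mathsf{l2vP}=\Lambda A.\lambda xs.\Lambda X.\Lambda P.\Lambda c_N.\Lambda c_C.\lambda p_N.\lambda p_C.\ \mathsf{elimList}\cdot A\ xs\cdot(\lambda xs{:}\mathsf{List}\cdot A.\ P(\mathsf{length}\cdot A\ xs)(\mathsf{l2vC}\cdot A\ xs\cdot X\ c_N\ c_C))\ p_N\ (\Lambda xs.\ p_C\ {-}(\mathsf{length}\cdot A\ xs)\ {-}(\mathsf{l2vC}\cdot A\ xs\cdot X\ c_N\ c_C))$; $\mathsf{l2vR}=\Lambda A.\lambda xs.\ xs.2$; $\mathsf{l2v}=\Lambda A.\lambda xs.\ \mathsf{mkVec}\cdot A\ {-}(\mathsf{length}\cdot A\ xs)\ [\mathsf{l2vC}\cdot A\ xs,\ \mathsf{l2vP}\cdot A\ xs]\ {-}(\mathsf{l2vR}\cdot A\ xs)$. **Length-constrained lists.** $\mathsf{VecL}\cdot A\ n=\iota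 xs{:}\mathsf{List}\cdot A.\ (n\simeq\mathsf{length}\cdot A\ xs)$. $\mathsf{mkVecL}:\forall A.\forall n.\Pi xs{:}\mathsf{List}\cdot A.\ (\mathsf{length}\cdot A\ xs\simeq n)\Rightarrow\mathsf{VecL}\cdot A\ n$ is $\Lambda A.\Lambda n.\lambda xs.\Lambda q.\,[xs,\ \rho\ q-\beta\{xs\}]$. $\mathsf{lengthPres}$ is a proof of $\forall A.\forall n.\Pi xs{:}\mathsf{Vec}\cdot A\ n.\ n\simeq\mathsf{length}\cdot A\ (\mathsf{v2l}\cdot A\ {-}n\ xs)$. $\mathsf{v2u}:\forall A.\forall n.\ \mathsf{Vec}\cdot A\ n\to\mathsf{VecL}\cdot A\ n$ is $\Lambda A.\Lambda n.\lambda xs.\ \mathsf{mkVecL}\cdot A\ {-}n\ (\mathsf{v2l}\cdot A\ {-}n\ xs)\ {-}(\varsigma\ (\mathsf{lengthPres}\cdot A\ {-}n\ xs))$. *)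

theory Defs
  imports Main
begin

section \<open>Syntax\<close>

text \<open>
  Raw syntax with names.  Term variables and type variables form two separate name spaces.
  Implicit abstraction over a value and over a type are written \<open>\<^bold>\<Lambda>x. t\<close> and
  \<open>\<^bold>\<Lambda>\<^sub>\<star>X. t\<close>; likewise \<open>\<^bold>\<forall>x:T. T'\<close> and
  \<open>\<^bold>\<forall>\<^sub>\<star>X:K. T\<close>.  Application to an explicit value, an implicit value
  and a type are \<open>t $ t'\<close>, \<open>t $- t'\<close> and \<open>t \<cdot> T\<close>; a type (constructor) is
  applied to a value by \<open>T $$ t\<close> and to a type by \<open>T \<cdot>\<cdot> T'\<close>.
\<close>

type_synonym name = string

datatype
  trm = V name
    | Lam name trm            ("\<^bold>\<lambda>_. _" [1000, 54] 54)
    | ILam name trm           ("\<^bold>\<Lambda>_. _" [1000, 54] 54)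
    | TLam name trm           ("\<^bold>\<Lambda>\<^sub>\<star>_. _" [1000, 54] 54)
    | App trm trm             (infixl "$" 80)
    | IApp trm trm            (infixl "$-" 80)
    | TApp trm ty             (infixl "\<cdot>" 80)
    | Pair trm trm
    | Fst trm
    | Snd trm
    | Beta
    | BetaT trm
    | Rho trm trm             ("\<rho> _ - _" [1000, 70] 70)
    | Sym trm
and
  ty  = TV name
    | Pi name ty ty           ("\<^bold>\<Pi>_:_. _" [1000, 55, 54] 54)
    | All name ty ty          ("\<^bold>\<forall>_:_. _" [1000, 55, 54] 54)
    | AllT name kd ty         ("\<^bold>\<forall>\<^sub>\<star>_:_. _" [1000, 55, 54] 54)
    | Iota name ty ty         ("\<^bold>\<iota>_:_. _" [1000, 55, 54] 54)
    | EqT trm trm             (infix "\<simeq>" 60)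
    | TyLam name ty ty        ("\<^bold>\<lambda>_:_. _" [1000, 55, 54] 54)
    | TyLamT name kd ty       ("\<^bold>\<lambda>\<^sub>\<star>_:_. _" [1000, 55, 54] 54)
    | TyApp ty trm            (infixl "$$" 80)
    | TyAppT ty ty            (infixl "\<cdot>\<cdot>" 80)
and
  kd  = Star
    | KPi name ty kd
    | KPiT name kd kd

text \<open>
  The name bound by the non-dependent arrows is the dummy \<open>''_''\<close>, which is never
  referred to below.
\<close>

abbreviation Arrow :: "ty \<Rightarrow> ty \<Rightarrow> ty"  (infixr "\<^bold>\<rightarrow>" 55)
  where "T \<^bold>\<rightarrow> T' \<equiv> Pi ''_'' T T'"

abbreviation KArrow :: "ty \<Rightarrow> kd \<Rightarrow> kd"
  where "KArrow T K \<equiv> KPi ''_'' T K"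


section \<open>Untyped terms, erasure, and equality of erased terms\<close>

datatype lam = LVar name | LLam name lam | LApp lam lam

primrec lfv :: "lam \<Rightarrow> name set" where
  "lfv (LVar x) = {x}"
| "lfv (LLam x M) = lfv M - {x}"
| "lfv (LApp M N) = lfv M \<union> lfv N"

definition pick :: "name \<Rightarrow> name set \<Rightarrow> name" where
  "pick x A = (if x \<notin> A then x else (SOME z. z \<notin> A))"

text \<open>Simultaneous capture-avoiding substitution: a bound name is changed only if it would capture.\<close>

primrec lsub :: "(name \<Rightarrow> lam) \<Rightarrow> lam \<Rightarrow> lam" where
  "lsub \<sigma> (LVar x) = \<sigma> x"
| "lsub \<sigma> (LLam x M) =
     (let z = pick x (\<Union>y \<in> lfv M - {x}. lfv (\<sigma> y)) in LLam z (lsub (\<sigma>(x := LVar z)) M))"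
| "lsub \<sigma> (LApp M N) = LApp (lsub \<sigma> M) (lsub \<sigma> N)"

abbreviation lsubst :: "lam \<Rightarrow> name \<Rightarrow> lam \<Rightarrow> lam" where
  "lsubst M x N \<equiv> lsub (LVar(x := N)) M"

inductive abe :: "lam \<Rightarrow> lam \<Rightarrow> bool"  (infix "=\<^sub>\<alpha>\<^sub>\<beta>\<^sub>\<eta>" 50) where
  abe_refl:  "M =\<^sub>\<alpha>\<^sub>\<beta>\<^sub>\<eta> M"
| abe_sym:   "M =\<^sub>\<alpha>\<^sub>\<beta>\<^sub>\<eta> N \<Longrightarrow> N =\<^sub>\<alpha>\<^sub>\<beta>\<^sub>\<eta> M"
| abe_trans: "M =\<^sub>\<alpha>\<^sub>\<beta>\<^sub>\<eta> N \<Longrightarrow> N =\<^sub>\<alpha>\<^sub>\<beta>\<^sub>\<eta> P \<Longrightarrow> M =\<^sub>\<alpha>\<^sub>\<beta>\<^sub>\<eta> P"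
| abe_app:   "M =\<^sub>\<alpha>\<^sub>\<beta>\<^sub>\<eta> M' \<Longrightarrow> N =\<^sub>\<alpha>\<^sub>\<beta>\<^sub>\<eta> N' \<Longrightarrow> LApp M N =\<^sub>\<alpha>\<^sub>\<beta>\<^sub>\<eta> LApp M' N'"
| abe_lam:   "M =\<^sub>\<alpha>\<^sub>\<beta>\<^sub>\<eta> M' \<Longrightarrow> LLam x M =\<^sub>\<alpha>\<^sub>\<beta>\<^sub>\<eta> LLam x M'"
| alpha:     "y \<notin> lfv M \<Longrightarrow> LLam x M =\<^sub>\<alpha>\<^sub>\<beta>\<^sub>\<eta> LLam y (lsubst M x (LVar y))"
| beta:      "LApp (LLam x M) N =\<^sub>\<alpha>\<^sub>\<beta>\<^sub>\<eta> lsubst M x N"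
| eta:       "x \<notin> lfv M \<Longrightarrow> LLam x (LApp M (LVar x)) =\<^sub>\<alpha>\<^sub>\<beta>\<^sub>\<eta> M"

primrec erase :: "trm \<Rightarrow> lam" where
  "erase (V x) = LVar x"
| "erase (Lam x t) = LLam x (erase t)"
| "erase (ILam x t) = erase t"
| "erase (TLam X t) = erase t"
| "erase (App t t') = LApp (erase t) (erase t')"
| "erase (IApp t t') = erase t"
| "erase (TApp t T) = erase t"
| "erase (Pair t t') = erase t"
| "erase (Fst t) = erase t"
| "erase (Snd t) = erase t"
| "erase Beta = LLam ''x'' (LVar ''x'')"
| "erase (BetaT t) = erase t"
| "erase (Rho q t) = erase t"
| "erase (Sym q) = erase q"


section \<open>Free variables and substitution for annotated syntax\<close>

datatype var = TmV name | TyV name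

primrec fv_trm :: "trm \<Rightarrow> var set" and fv_ty :: "ty \<Rightarrow> var set" and fv_kd :: "kd \<Rightarrow> var set" where
  "fv_trm (V x) = {TmV x}"
| "fv_trm (Lam x t) = fv_trm t - {TmV x}"
| "fv_trm (ILam x t) = fv_trm t - {TmV x}"
| "fv_trm (TLam X t) = fv_trm t - {TyV X}"
| "fv_trm (App t t') = fv_trm t \<union> fv_trm t'"
| "fv_trm (IApp t t') = fv_trm t \<union> fv_trm t'"
| "fv_trm (TApp t T) = fv_trm t \<union> fv_ty T"
| "fv_trm (Pair t t') = fv_trm t \<union> fv_trm t'"
| "fv_trm (Fst t) = fv_trm t"
| "fv_trm (Snd t) = fv_trm t"
| "fv_trm Beta = {}"
| "fv_trm (BetaT t) = fv_trm t"
| "fv_trm (Rho q t) = fv_trm q \<union> fv_trm t"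
| "fv_trm (Sym q) = fv_trm q"
| "fv_ty (TV X) = {TyV X}"
| "fv_ty (Pi x T T') = fv_ty T \<union> (fv_ty T' - {TmV x})"
| "fv_ty (All x T T') = fv_ty T \<union> (fv_ty T' - {TmV x})"
| "fv_ty (AllT X K T) = fv_kd K \<union> (fv_ty T - {TyV X})"
| "fv_ty (Iota x T T') = fv_ty T \<union> (fv_ty T' - {TmV x})"
| "fv_ty (EqT t t') = fv_trm t \<union> fv_trm t'"
| "fv_ty (TyLam x T T') = fv_ty T \<union> (fv_ty T' - {TmV x})"
| "fv_ty (TyLamT X K T) = fv_kd K \<union> (fv_ty T - {TyV X})"
| "fv_ty (TyApp T t) = fv_ty T \<union> fv_trm t"
| "fv_ty (TyAppT T T') = fv_ty T \<union> fv_ty T'"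
| "fv_kd Star = {}"
| "fv_kd (KPi x T K) = fv_ty T \<union> (fv_kd K - {TmV x})"
| "fv_kd (KPiT X K K') = fv_kd K \<union> (fv_kd K' - {TyV X})"

text \<open>
  \<open>image_fv \<sigma> \<tau> S\<close> collects the variables that occur free once the variables in \<open>S\<close>
  have been replaced according to \<open>\<sigma>\<close> and \<open>\<tau>\<close>.
\<close>

definition image_fv :: "(name \<Rightarrow> trm) \<Rightarrow> (name \<Rightarrow> ty) \<Rightarrow> var set \<Rightarrow> var set" where
  "image_fv \<sigma> \<tau> S = (\<Union>v \<in> S. case v of TmV x \<Rightarrow> fv_trm (\<sigma> x) | TyV X \<Rightarrow> fv_ty (\<tau> X))"

definition new_tm :: "(name \<Rightarrow> trm) \<Rightarrow> (name \<Rightarrow> ty) \<Rightarrow> name \<Rightarrow> var set \<Rightarrow> name" where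
  "new_tm \<sigma> \<tau> x S = pick x {z. TmV z \<in> image_fv \<sigma> \<tau> (S - {TmV x})}"

definition new_ty :: "(name \<Rightarrow> trm) \<Rightarrow> (name \<Rightarrow> ty) \<Rightarrow> name \<Rightarrow> var set \<Rightarrow> name" where
  "new_ty \<sigma> \<tau> X S = pick X {Z. TyV Z \<in> image_fv \<sigma> \<tau> (S - {TyV X})}"

primrec sub_trm :: "(name \<Rightarrow> trm) \<Rightarrow> (name \<Rightarrow> ty) \<Rightarrow> trm \<Rightarrow> trm"
  and sub_ty :: "(name \<Rightarrow> trm) \<Rightarrow> (name \<Rightarrow> ty) \<Rightarrow> ty \<Rightarrow> ty"
  and sub_kd :: "(name \<Rightarrow> trm) \<Rightarrow> (name \<Rightarrow> ty) \<Rightarrow> kd \<Rightarrow> kd" where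
  "sub_trm \<sigma> \<tau> (V x) = \<sigma> x"
| "sub_trm \<sigma> \<tau> (Lam x t) = (let z = new_tm \<sigma> \<tau> x (fv_trm t) in Lam z (sub_trm (\<sigma>(x := V z)) \<tau> t))"
| "sub_trm \<sigma> \<tau> (ILam x t) = (let z = new_tm \<sigma> \<tau> x (fv_trm t) in ILam z (sub_trm (\<sigma>(x := V z)) \<tau> t))"
| "sub_trm \<sigma> \<tau> (TLam X t) = (let Z = new_ty \<sigma> \<tau> X (fv_trm t) in TLam Z (sub_trm \<sigma> (\<tau>(X := TV Z)) t))"
| "sub_trm \<sigma> \<tau> (App t t') = App (sub_trm \<sigma> \<tau> t) (sub_trm \<sigma> \<tau> t')"
| "sub_trm \<sigma> \<tau> (IApp t t') = IApp (sub_trm \<sigma> \<tau> t) (sub_trm \<sigma> \<tau> t')"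
| "sub_trm \<sigma> \<tau> (TApp t T) = TApp (sub_trm \<sigma> \<tau> t) (sub_ty \<sigma> \<tau> T)"
| "sub_trm \<sigma> \<tau> (Pair t t') = Pair (sub_trm \<sigma> \<tau> t) (sub_trm \<sigma> \<tau> t')"
| "sub_trm \<sigma> \<tau> (Fst t) = Fst (sub_trm \<sigma> \<tau> t)"
| "sub_trm \<sigma> \<tau> (Snd t) = Snd (sub_trm \<sigma> \<tau> t)"
| "sub_trm \<sigma> \<tau> Beta = Beta"
| "sub_trm \<sigma> \<tau> (BetaT t) = BetaT (sub_trm \<sigma> \<tau> t)"
| "sub_trm \<sigma> \<tau> (Rho q t) = Rho (sub_trm \<sigma> \<tau> q) (sub_trm \<sigma> \<tau> t)"
| "sub_trm \<sigma> \<tau> (Sym q) = Sym (sub_trm \<sigma> \<tau> q)"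
| "sub_ty \<sigma> \<tau> (TV X) = \<tau> X"
| "sub_ty \<sigma> \<tau> (Pi x T T') =
     (let z = new_tm \<sigma> \<tau> x (fv_ty T') in Pi z (sub_ty \<sigma> \<tau> T) (sub_ty (\<sigma>(x := V z)) \<tau> T'))"
| "sub_ty \<sigma> \<tau> (All x T T') =
     (let z = new_tm \<sigma> \<tau> x (fv_ty T') in All z (sub_ty \<sigma> \<tau> T) (sub_ty (\<sigma>(x := V z)) \<tau> T'))"
| "sub_ty \<sigma> \<tau> (AllT X K T) =
     (let Z = new_ty \<sigma> \<tau> X (fv_ty T) in AllT Z (sub_kd \<sigma> \<tau> K) (sub_ty \<sigma> (\<tau>(X := TV Z)) T))"
| "sub_ty \<sigma> \<tau> (Iota x T T') =
     (let z = new_tm \<sigma> \<tau> x (fv_ty T') in Iota z (sub_ty \<sigma> \<tau> T) (sub_ty (\<sigma>(x := V z)) \<tau> T'))"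
| "sub_ty \<sigma> \<tau> (EqT t t') = EqT (sub_trm \<sigma> \<tau> t) (sub_trm \<sigma> \<tau> t')"
| "sub_ty \<sigma> \<tau> (TyLam x T T') =
     (let z = new_tm \<sigma> \<tau> x (fv_ty T') in TyLam z (sub_ty \<sigma> \<tau> T) (sub_ty (\<sigma>(x := V z)) \<tau> T'))"
| "sub_ty \<sigma> \<tau> (TyLamT X K T) =
     (let Z = new_ty \<sigma> \<tau> X (fv_ty T) in TyLamT Z (sub_kd \<sigma> \<tau> K) (sub_ty \<sigma> (\<tau>(X := TV Z)) T))"
| "sub_ty \<sigma> \<tau> (TyApp T t) = TyApp (sub_ty \<sigma> \<tau> T) (sub_trm \<sigma> \<tau> t)"
| "sub_ty \<sigma> \<tau> (TyAppT T T') = TyAppT (sub_ty \<sigma> \<tau> T) (sub_ty \<sigma> \<tau> T')"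
| "sub_kd \<sigma> \<tau> Star = Star"
| "sub_kd \<sigma> \<tau> (KPi x T K) =
     (let z = new_tm \<sigma> \<tau> x (fv_kd K) in KPi z (sub_ty \<sigma> \<tau> T) (sub_kd (\<sigma>(x := V z)) \<tau> K))"
| "sub_kd \<sigma> \<tau> (KPiT X K K') =
     (let Z = new_ty \<sigma> \<tau> X (fv_kd K') in KPiT Z (sub_kd \<sigma> \<tau> K) (sub_kd \<sigma> (\<tau>(X := TV Z)) K'))"

abbreviation subst_tt ("_[_ ::= _]\<^sub>t" [900, 0, 0] 900)
  where "t[x ::= s]\<^sub>t \<equiv> sub_trm (V(x := s)) TV t"
abbreviation subst_tyt ("_[_ ::= _]\<^sub>t\<^sub>T" [900, 0, 0] 900)
  where "t[X ::= S]\<^sub>t\<^sub>T \<equiv> sub_trm V (TV(X := S)) t"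
abbreviation subst_ty ("_[_ ::= _]\<^sub>T" [900, 0, 0] 900)
  where "T[x ::= s]\<^sub>T \<equiv> sub_ty (V(x := s)) TV T"
abbreviation subst_tyty ("_[_ ::= _]\<^sub>T\<^sub>T" [900, 0, 0] 900)
  where "T[X ::= S]\<^sub>T\<^sub>T \<equiv> sub_ty V (TV(X := S)) T"
abbreviation subst_kd ("_[_ ::= _]\<^sub>K" [900, 0, 0] 900)
  where "K[x ::= s]\<^sub>K \<equiv> sub_kd (V(x := s)) TV K"
abbreviation subst_tykd ("_[_ ::= _]\<^sub>K\<^sub>T" [900, 0, 0] 900)
  where "K[X ::= S]\<^sub>K\<^sub>T \<equiv> sub_kd V (TV(X := S)) K"


section \<open>Typing\<close>

text \<open>
  Conversion of types and kinds: terms inside types are compared up to erasure, and type-level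
  redexes may be contracted.  All rules that go under a binder are in cofinite style: the premise
  is required for all names outside some finite set.  The two bound names need not agree, so
  \<open>\<alpha>\<close>-equivalence is built in.
\<close>

inductive tconv :: "ty \<Rightarrow> ty \<Rightarrow> bool"  (infix "\<cong>" 50)
  and kconv :: "kd \<Rightarrow> kd \<Rightarrow> bool"  (infix "\<cong>\<^sub>K" 50) where
  tc_refl:  "T \<cong> T"
| tc_sym:   "T \<cong> S \<Longrightarrow> S \<cong> T"
| tc_trans: "T \<cong> S \<Longrightarrow> S \<cong> R \<Longrightarrow> T \<cong> R"
| tc_Pi:    "T \<cong> S \<Longrightarrow> finite L \<Longrightarrow> (\<And>z. z \<notin> L \<Longrightarrow> T'[x ::= V z]\<^sub>T \<cong> S'[y ::= V z]\<^sub>T) \<Longrightarrow> Pi x T T' \<cong> Pi y S S'"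
| tc_All:   "T \<cong> S \<Longrightarrow> finite L \<Longrightarrow> (\<And>z. z \<notin> L \<Longrightarrow> T'[x ::= V z]\<^sub>T \<cong> S'[y ::= V z]\<^sub>T) \<Longrightarrow> All x T T' \<cong> All y S S'"
| tc_AllT:  "K \<cong>\<^sub>K K' \<Longrightarrow> finite L \<Longrightarrow> (\<And>Z. Z \<notin> L \<Longrightarrow> T[X ::= TV Z]\<^sub>T\<^sub>T \<cong> S[Y ::= TV Z]\<^sub>T\<^sub>T) \<Longrightarrow> AllT X K T \<cong> AllT Y K' S"
| tc_Iota:  "T \<cong> S \<Longrightarrow> finite L \<Longrightarrow> (\<And>z. z \<notin> L \<Longrightarrow> T'[x ::= V z]\<^sub>T \<cong> S'[y ::= V z]\<^sub>T) \<Longrightarrow> Iota x T T' \<cong> Iota y S S'"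
| tc_EqT:   "erase t =\<^sub>\<alpha>\<^sub>\<beta>\<^sub>\<eta> erase s \<Longrightarrow> erase t' =\<^sub>\<alpha>\<^sub>\<beta>\<^sub>\<eta> erase s' \<Longrightarrow> (t \<simeq> t') \<cong> (s \<simeq> s')"
| tc_TyLam: "T \<cong> S \<Longrightarrow> finite L \<Longrightarrow> (\<And>z. z \<notin> L \<Longrightarrow> T'[x ::= V z]\<^sub>T \<cong> S'[y ::= V z]\<^sub>T) \<Longrightarrow> TyLam x T T' \<cong> TyLam y S S'"
| tc_TyLamT: "K \<cong>\<^sub>K K' \<Longrightarrow> finite L \<Longrightarrow> (\<And>Z. Z \<notin> L \<Longrightarrow> T[X ::= TV Z]\<^sub>T\<^sub>T \<cong> S[Y ::= TV Z]\<^sub>T\<^sub>T) \<Longrightarrow> TyLamT X K T \<cong> TyLamT Y K' S"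
| tc_TyApp: "T \<cong> S \<Longrightarrow> erase t =\<^sub>\<alpha>\<^sub>\<beta>\<^sub>\<eta> erase s \<Longrightarrow> T $$ t \<cong> S $$ s"
| tc_TyAppT: "T \<cong> S \<Longrightarrow> T' \<cong> S' \<Longrightarrow> T \<cdot>\<cdot> T' \<cong> S \<cdot>\<cdot> S'"
| tc_beta:  "TyLam x S T $$ t \<cong> T[x ::= t]\<^sub>T"
| tc_betaT: "TyLamT X K T \<cdot>\<cdot> S \<cong> T[X ::= S]\<^sub>T\<^sub>T"
| kc_refl:  "K \<cong>\<^sub>K K"
| kc_sym:   "K \<cong>\<^sub>K K' \<Longrightarrow> K' \<cong>\<^sub>K K"
| kc_trans: "K \<cong>\<^sub>K K' \<Longrightarrow> K' \<cong>\<^sub>K K'' \<Longrightarrow> K \<cong>\<^sub>K K''"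
| kc_KPi:   "T \<cong> S \<Longrightarrow> finite L \<Longrightarrow> (\<And>z. z \<notin> L \<Longrightarrow> K[x ::= V z]\<^sub>K \<cong>\<^sub>K K'[y ::= V z]\<^sub>K) \<Longrightarrow> KPi x T K \<cong>\<^sub>K KPi y S K'"
| kc_KPiT:  "J \<cong>\<^sub>K J' \<Longrightarrow> finite L \<Longrightarrow> (\<And>Z. Z \<notin> L \<Longrightarrow> K[X ::= TV Z]\<^sub>K\<^sub>T \<cong>\<^sub>K K'[Y ::= TV Z]\<^sub>K\<^sub>T) \<Longrightarrow> KPiT X J K \<cong>\<^sub>K KPiT Y J' K'"

datatype decl = TmD name ty | TyD name kd

primrec decl_var :: "decl \<Rightarrow> var" where
  "decl_var (TmD x T) = TmV x"
| "decl_var (TyD X K) = TyV X"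

text \<open>
  The equality type and \<open>\<beta>{t}\<close> accept arbitrary, possibly untypable, terms; these must only be
  in scope.  The second conjunct is not implied by the first, since erasing \<open>\<^bold>\<Lambda>x. t\<close>
  removes a binder.
\<close>

definition scoped :: "decl list \<Rightarrow> trm \<Rightarrow> bool" where
  "scoped \<Gamma> t \<longleftrightarrow> fv_trm t \<subseteq> decl_var ` set \<Gamma> \<and> TmV ` lfv (erase t) \<subseteq> decl_var ` set \<Gamma>"

text \<open>
  In \<open>\<rho> q - t\<close> with \<open>q : t\<^sub>1 \<simeq> t\<^sub>2\<close> it is the expected type that is rewritten from left to
  right, so \<open>t\<close> has to have the rewritten type.
\<close>

inductive kind_ok :: "decl list \<Rightarrow> kd \<Rightarrow> bool"  ("_ \<turnstile>\<^sub>K _" [50, 50] 50)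
  and kinding :: "decl list \<Rightarrow> ty \<Rightarrow> kd \<Rightarrow> bool"  ("_ \<turnstile>\<^sub>T _ : _" [50, 50, 50] 50)
  and typing :: "decl list \<Rightarrow> trm \<Rightarrow> ty \<Rightarrow> bool"  ("_ \<turnstile> _ : _" [50, 50, 50] 50) where
  k_Star: "\<Gamma> \<turnstile>\<^sub>K Star"
| k_Pi:   "\<Gamma> \<turnstile>\<^sub>T T : Star \<Longrightarrow> finite L \<Longrightarrow> (\<And>z. z \<notin> L \<Longrightarrow> TmD z T # \<Gamma> \<turnstile>\<^sub>K K[x ::= V z]\<^sub>K) \<Longrightarrow> \<Gamma> \<turnstile>\<^sub>K KPi x T K"
| k_PiT:  "\<Gamma> \<turnstile>\<^sub>K K \<Longrightarrow> finite L \<Longrightarrow> (\<And>Z. Z \<notin> L \<Longrightarrow> TyD Z K # \<Gamma> \<turnstile>\<^sub>K K'[X ::= TV Z]\<^sub>K\<^sub>T) \<Longrightarrow> \<Gamma> \<turnstile>\<^sub>K KPiT X K K'"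

| T_var:  "TyD X K \<in> set \<Gamma> \<Longrightarrow> \<Gamma> \<turnstile>\<^sub>T TV X : K"
| T_Pi:   "\<Gamma> \<turnstile>\<^sub>T T : Star \<Longrightarrow> finite L \<Longrightarrow> (\<And>z. z \<notin> L \<Longrightarrow> TmD z T # \<Gamma> \<turnstile>\<^sub>T T'[x ::= V z]\<^sub>T : Star) \<Longrightarrow> \<Gamma> \<turnstile>\<^sub>T Pi x T T' : Star"
| T_All:  "\<Gamma> \<turnstile>\<^sub>T T : Star \<Longrightarrow> finite L \<Longrightarrow> (\<And>z. z \<notin> L \<Longrightarrow> TmD z T # \<Gamma> \<turnstile>\<^sub>T T'[x ::= V z]\<^sub>T : Star) \<Longrightarrow> \<Gamma> \<turnstile>\<^sub>T All x T T' : Star"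
| T_AllT: "\<Gamma> \<turnstile>\<^sub>K K \<Longrightarrow> finite L \<Longrightarrow> (\<And>Z. Z \<notin> L \<Longrightarrow> TyD Z K # \<Gamma> \<turnstile>\<^sub>T T[X ::= TV Z]\<^sub>T\<^sub>T : Star) \<Longrightarrow> \<Gamma> \<turnstile>\<^sub>T AllT X K T : Star"
| T_Iota: "\<Gamma> \<turnstile>\<^sub>T T : Star \<Longrightarrow> finite L \<Longrightarrow> (\<And>z. z \<notin> L \<Longrightarrow> TmD z T # \<Gamma> \<turnstile>\<^sub>T T'[x ::= V z]\<^sub>T : Star) \<Longrightarrow> \<Gamma> \<turnstile>\<^sub>T Iota x T T' : Star"
| T_Eq:   "scoped \<Gamma> t \<Longrightarrow> scoped \<Gamma> t' \<Longrightarrow> \<Gamma> \<turnstile>\<^sub>T (t \<simeq> t') : Star"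
| T_Lam:  "\<Gamma> \<turnstile>\<^sub>T T : Star \<Longrightarrow> finite L \<Longrightarrow> (\<And>z. z \<notin> L \<Longrightarrow> TmD z T # \<Gamma> \<turnstile>\<^sub>T T'[x ::= V z]\<^sub>T : K[y ::= V z]\<^sub>K) \<Longrightarrow> \<Gamma> \<turnstile>\<^sub>T TyLam x T T' : KPi y T K"
| T_LamT: "\<Gamma> \<turnstile>\<^sub>K K \<Longrightarrow> finite L \<Longrightarrow> (\<And>Z. Z \<notin> L \<Longrightarrow> TyD Z K # \<Gamma> \<turnstile>\<^sub>T T[X ::= TV Z]\<^sub>T\<^sub>T : K'[Y ::= TV Z]\<^sub>K\<^sub>T) \<Longrightarrow> \<Gamma> \<turnstile>\<^sub>T TyLamT X K T : KPiT Y K K'"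
| T_App:  "\<Gamma> \<turnstile>\<^sub>T T : KPi x S K \<Longrightarrow> \<Gamma> \<turnstile> t : S \<Longrightarrow> \<Gamma> \<turnstile>\<^sub>T T $$ t : K[x ::= t]\<^sub>K"
| T_AppT: "\<Gamma> \<turnstile>\<^sub>T T : KPiT X K K' \<Longrightarrow> \<Gamma> \<turnstile>\<^sub>T S : K \<Longrightarrow> \<Gamma> \<turnstile>\<^sub>T T \<cdot>\<cdot> S : K'[X ::= S]\<^sub>K\<^sub>T"
| T_conv: "\<Gamma> \<turnstile>\<^sub>T T : K \<Longrightarrow> K \<cong>\<^sub>K K' \<Longrightarrow> \<Gamma> \<turnstile>\<^sub>K K' \<Longrightarrow> \<Gamma> \<turnstile>\<^sub>T T : K'"

| t_var:  "TmD x T \<in> set \<Gamma> \<Longrightarrow> \<Gamma> \<turnstile> V x : T"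
| t_Lam:  "\<Gamma> \<turnstile>\<^sub>T T : Star \<Longrightarrow> finite L \<Longrightarrow> (\<And>z. z \<notin> L \<Longrightarrow> TmD z T # \<Gamma> \<turnstile> t[x ::= V z]\<^sub>t : T'[y ::= V z]\<^sub>T) \<Longrightarrow> \<Gamma> \<turnstile> Lam x t : Pi y T T'"
| t_App:  "\<Gamma> \<turnstile> t : Pi x T T' \<Longrightarrow> \<Gamma> \<turnstile> s : T \<Longrightarrow> \<Gamma> \<turnstile> t $ s : T'[x ::= s]\<^sub>T"
| t_ILam: "\<Gamma> \<turnstile>\<^sub>T T : Star \<Longrightarrow> finite L \<Longrightarrow> (\<And>z. z \<notin> L \<Longrightarrow> TmD z T # \<Gamma> \<turnstile> t[x ::= V z]\<^sub>t : T'[y ::= V z]\<^sub>T) \<Longrightarrow>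
             (\<And>z. z \<notin> L \<Longrightarrow> z \<notin> lfv (erase (t[x ::= V z]\<^sub>t))) \<Longrightarrow> \<Gamma> \<turnstile> ILam x t : All y T T'"
| t_IApp: "\<Gamma> \<turnstile> t : All x T T' \<Longrightarrow> \<Gamma> \<turnstile> s : T \<Longrightarrow> \<Gamma> \<turnstile> t $- s : T'[x ::= s]\<^sub>T"
| t_TLam: "\<Gamma> \<turnstile>\<^sub>K K \<Longrightarrow> finite L \<Longrightarrow> (\<And>Z. Z \<notin> L \<Longrightarrow> TyD Z K # \<Gamma> \<turnstile> t[X ::= TV Z]\<^sub>t\<^sub>T : T[Y ::= TV Z]\<^sub>T\<^sub>T) \<Longrightarrow> \<Gamma> \<turnstile> TLam X t : AllT Y K T"
| t_TApp: "\<Gamma> \<turnstile> t : AllT X K T \<Longrightarrow> \<Gamma> \<turnstile>\<^sub>T S : K \<Longrightarrow> \<Gamma> \<turnstile> t \<cdot> S : T[X ::= S]\<^sub>T\<^sub>T"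
| t_Pair: "\<Gamma> \<turnstile>\<^sub>T Iota x T T' : Star \<Longrightarrow> \<Gamma> \<turnstile> t : T \<Longrightarrow> \<Gamma> \<turnstile> t' : T'[x ::= t]\<^sub>T \<Longrightarrow>
             erase t =\<^sub>\<alpha>\<^sub>\<beta>\<^sub>\<eta> erase t' \<Longrightarrow> \<Gamma> \<turnstile> Pair t t' : Iota x T T'"
| t_Fst:  "\<Gamma> \<turnstile> t : Iota x T T' \<Longrightarrow> \<Gamma> \<turnstile> Fst t : T"
| t_Snd:  "\<Gamma> \<turnstile> t : Iota x T T' \<Longrightarrow> \<Gamma> \<turnstile> Snd t : T'[x ::= Fst t]\<^sub>T"
| t_Beta: "scoped \<Gamma> t \<Longrightarrow> \<Gamma> \<turnstile> Beta : (t \<simeq> t)"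
| t_BetaT: "scoped \<Gamma> t \<Longrightarrow> scoped \<Gamma> t' \<Longrightarrow> \<Gamma> \<turnstile> BetaT t' : (t \<simeq> t)"
| t_Rho:  "\<Gamma> \<turnstile> q : (t1 \<simeq> t2) \<Longrightarrow> \<Gamma> \<turnstile>\<^sub>T T[x ::= t1]\<^sub>T : Star \<Longrightarrow> \<Gamma> \<turnstile> t : T[x ::= t2]\<^sub>T \<Longrightarrow> \<Gamma> \<turnstile> \<rho> q - t : T[x ::= t1]\<^sub>T"
| t_Sym:  "\<Gamma> \<turnstile> q : (t1 \<simeq> t2) \<Longrightarrow> \<Gamma> \<turnstile> Sym q : (t2 \<simeq> t1)"
| t_conv: "\<Gamma> \<turnstile> t : T \<Longrightarrow> T \<cong> T' \<Longrightarrow> \<Gamma> \<turnstile>\<^sub>T T' : Star \<Longrightarrow> \<Gamma> \<turnstile> t : T'"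


section \<open>Natural numbers\<close>

text \<open>
  All constants from here on are closed expressions, so that unfolding them under binders cannot
  capture anything.  Naturals are derived by the same recipe as lists.
\<close>

definition NatC :: ty where
  "NatC = \<^bold>\<forall>\<^sub>\<star>''X'':Star. TV ''X'' \<^bold>\<rightarrow> (TV ''X'' \<^bold>\<rightarrow> TV ''X'') \<^bold>\<rightarrow> TV ''X''"

definition zeroC :: trm where
  "zeroC = \<^bold>\<Lambda>\<^sub>\<star>''X''. \<^bold>\<lambda>''cZ''. \<^bold>\<lambda>''cS''. V ''cZ''"

definition sucC :: trm where
  "sucC = \<^bold>\<lambda>''n''. \<^bold>\<Lambda>\<^sub>\<star>''X''. \<^bold>\<lambda>''cZ''. \<^bold>\<lambda>''cS''. V ''cS'' $ (V ''n'' \<cdot> TV ''X'' $ V ''cZ'' $ V ''cS'')"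

definition NatP :: ty where
  "NatP = \<^bold>\<lambda>''nC'':NatC.
     \<^bold>\<forall>\<^sub>\<star>''X'':Star. \<^bold>\<forall>\<^sub>\<star>''P'':KArrow (TV ''X'') Star.
     \<^bold>\<forall>''cZ'':TV ''X''. \<^bold>\<forall>''cS'':(TV ''X'' \<^bold>\<rightarrow> TV ''X'').
       TV ''P'' $$ V ''cZ'' \<^bold>\<rightarrow>
       (\<^bold>\<forall>''n'':TV ''X''. TV ''P'' $$ V ''n'' \<^bold>\<rightarrow> TV ''P'' $$ (V ''cS'' $ V ''n'')) \<^bold>\<rightarrow>
       TV ''P'' $$ (V ''nC'' \<cdot> TV ''X'' $ V ''cZ'' $ V ''cS'')"

definition NatR :: ty where
  "NatR = \<^bold>\<lambda>''nC'':NatC. (V ''nC'' \<cdot> NatC $ zeroC $ sucC \<simeq> V ''nC'')"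

definition Nat :: ty where
  "Nat = \<^bold>\<iota>''n'':(\<^bold>\<iota>''nC'':NatC. NatP $$ V ''nC''). NatR $$ Fst (V ''n'')"

definition mkNat :: trm where
  "mkNat = \<^bold>\<lambda>''n''. \<^bold>\<Lambda>''q''. Pair (V ''n'') (\<rho> (V ''q'') - BetaT (V ''n''))"

definition zeroP :: trm where
  "zeroP = \<^bold>\<Lambda>\<^sub>\<star>''X''. \<^bold>\<Lambda>\<^sub>\<star>''P''. \<^bold>\<Lambda>''cZ''. \<^bold>\<Lambda>''cS''. \<^bold>\<lambda>''pZ''. \<^bold>\<lambda>''pS''. V ''pZ''"

definition zero :: trm where
  "zero = mkNat $ Pair zeroC zeroP $- Beta"

definition sucP :: trm where
  "sucP = \<^bold>\<lambda>''n''. \<^bold>\<Lambda>\<^sub>\<star>''X''. \<^bold>\<Lambda>\<^sub>\<star>''P''. \<^bold>\<Lambda>''cZ''. \<^bold>\<Lambda>''cS''. \<^bold>\<lambda>''pZ''. \<^bold>\<lambda>''pS''.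
     V ''pS'' $- (Fst (Fst (V ''n'')) \<cdot> TV ''X'' $ V ''cZ'' $ V ''cS'')
       $ (Snd (Fst (V ''n'')) \<cdot> TV ''X'' \<cdot> TV ''P'' $- V ''cZ'' $- V ''cS'' $ V ''pZ'' $ V ''pS'')"

definition suc :: trm where
  "suc = \<^bold>\<lambda>''n''. mkNat $ Pair (sucC $ Fst (Fst (V ''n''))) (sucP $ V ''n'')
                      $- (\<rho> (Snd (V ''n'')) - Beta)"

definition add :: trm where
  "add = \<^bold>\<lambda>''n''. \<^bold>\<lambda>''m''. Fst (Fst (V ''n'')) \<cdot> Nat $ V ''m'' $ suc"


section \<open>Lists\<close>

definition ListC :: ty where
  "ListC = \<^bold>\<lambda>\<^sub>\<star>''A'':Star. \<^bold>\<forall>\<^sub>\<star>''X'':Star.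
     TV ''X'' \<^bold>\<rightarrow> (TV ''A'' \<^bold>\<rightarrow> TV ''X'' \<^bold>\<rightarrow> TV ''X'') \<^bold>\<rightarrow> TV ''X''"

definition nilCL :: trm where
  "nilCL = \<^bold>\<Lambda>\<^sub>\<star>''A''. \<^bold>\<Lambda>\<^sub>\<star>''X''. \<^bold>\<lambda>''cN''. \<^bold>\<lambda>''cC''. V ''cN''"

definition consCL :: trm where
  "consCL = \<^bold>\<Lambda>\<^sub>\<star>''A''. \<^bold>\<lambda>''x''. \<^bold>\<lambda>''xs''. \<^bold>\<Lambda>\<^sub>\<star>''X''. \<^bold>\<lambda>''cN''. \<^bold>\<lambda>''cC''.
     V ''cC'' $ V ''x'' $ (V ''xs'' \<cdot> TV ''X'' $ V ''cN'' $ V ''cC'')"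

definition ListP :: ty where
  "ListP = \<^bold>\<lambda>\<^sub>\<star>''A'':Star. \<^bold>\<lambda>''xsC'':ListC \<cdot>\<cdot> TV ''A''.
     \<^bold>\<forall>\<^sub>\<star>''X'':Star. \<^bold>\<forall>\<^sub>\<star>''P'':KArrow (TV ''X'') Star.
     \<^bold>\<forall>''cN'':TV ''X''. \<^bold>\<forall>''cC'':(TV ''A'' \<^bold>\<rightarrow> TV ''X'' \<^bold>\<rightarrow> TV ''X'').
       TV ''P'' $$ V ''cN'' \<^bold>\<rightarrow>
       (\<^bold>\<forall>''xs'':TV ''X''. \<^bold>\<Pi>''x'':TV ''A''.
          TV ''P'' $$ V ''xs'' \<^bold>\<rightarrow> TV ''P'' $$ (V ''cC'' $ V ''x'' $ V ''xs'')) \<^bold>\<rightarrow>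
       TV ''P'' $$ (V ''xsC'' \<cdot> TV ''X'' $ V ''cN'' $ V ''cC'')"

definition ListR :: ty where
  "ListR = \<^bold>\<lambda>\<^sub>\<star>''A'':Star. \<^bold>\<lambda>''xsC'':ListC \<cdot>\<cdot> TV ''A''.
     (V ''xsC'' \<cdot> (ListC \<cdot>\<cdot> TV ''A'') $ nilCL $ consCL \<simeq> V ''xsC'')"

definition List :: ty where
  "List = \<^bold>\<lambda>\<^sub>\<star>''A'':Star.
     \<^bold>\<iota>''xs'':(\<^bold>\<iota>''xsC'':ListC \<cdot>\<cdot> TV ''A''. ListP \<cdot>\<cdot> TV ''A'' $$ V ''xsC'').
       ListR \<cdot>\<cdot> TV ''A'' $$ Fst (V ''xs'')"

definition mkList :: trm where
  "mkList = \<^bold>\<Lambda>\<^sub>\<star>''A''. \<^bold>\<lambda>''xs''. \<^bold>\<Lambda>''q''. Pair (V ''xs'') (\<rho> (V ''q'') - BetaT (V ''xs''))"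

definition nilPL :: trm where
  "nilPL = \<^bold>\<Lambda>\<^sub>\<star>''A''. \<^bold>\<Lambda>\<^sub>\<star>''X''. \<^bold>\<Lambda>\<^sub>\<star>''P''. \<^bold>\<Lambda>''cN''. \<^bold>\<Lambda>''cC''. \<^bold>\<lambda>''pN''. \<^bold>\<lambda>''pC''. V ''pN''"

definition nilL :: trm where
  "nilL = \<^bold>\<Lambda>\<^sub>\<star>''A''. mkList \<cdot> TV ''A'' $ Pair (nilCL \<cdot> TV ''A'') (nilPL \<cdot> TV ''A'') $- Beta"

definition consPL :: trm where
  "consPL = \<^bold>\<Lambda>\<^sub>\<star>''A''. \<^bold>\<lambda>''x''. \<^bold>\<lambda>''xs''. \<^bold>\<Lambda>\<^sub>\<star>''X''. \<^bold>\<Lambda>\<^sub>\<star>''P''. \<^bold>\<Lambda>''cN''. \<^bold>\<Lambda>''cC''. \<^bold>\<lambda>''pN''. \<^bold>\<lambda>''pC''.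
     V ''pC'' $- (Fst (Fst (V ''xs'')) \<cdot> TV ''X'' $ V ''cN'' $ V ''cC'') $ V ''x''
       $ (Snd (Fst (V ''xs'')) \<cdot> TV ''X'' \<cdot> TV ''P'' $- V ''cN'' $- V ''cC'' $ V ''pN'' $ V ''pC'')"

definition consL :: trm where
  "consL = \<^bold>\<Lambda>\<^sub>\<star>''A''. \<^bold>\<lambda>''x''. \<^bold>\<lambda>''xs''.
     mkList \<cdot> TV ''A''
       $ Pair (consCL \<cdot> TV ''A'' $ V ''x'' $ Fst (Fst (V ''xs''))) (consPL \<cdot> TV ''A'' $ V ''x'' $ V ''xs'')
       $- (\<rho> (Snd (V ''xs'')) - Beta)"

definition elimList :: trm where
  "elimList = \<^bold>\<Lambda>\<^sub>\<star>''A''. \<^bold>\<lambda>''xs''. \<^bold>\<Lambda>\<^sub>\<star>''P''.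
     \<rho> (Sym (Snd (V ''xs''))) -
       (Snd (Fst (V ''xs'')) \<cdot> (List \<cdot>\<cdot> TV ''A'') \<cdot> TV ''P''
          $- (nilL \<cdot> TV ''A'') $- (consL \<cdot> TV ''A''))"

definition lengthL :: trm where
  "lengthL = \<^bold>\<Lambda>\<^sub>\<star>''A''. \<^bold>\<lambda>''xs''.
     elimList \<cdot> TV ''A'' $ V ''xs'' \<cdot> (\<^bold>\<lambda>''_'':List \<cdot>\<cdot> TV ''A''. Nat)
       $ zero $ (\<^bold>\<Lambda>''_''. \<^bold>\<lambda>''x''. \<^bold>\<lambda>''r''. suc $ V ''r'')"


section \<open>Vectors\<close>

definition VecC :: ty where
  "VecC = \<^bold>\<lambda>\<^sub>\<star>''A'':Star. \<^bold>\<lambda>''n'':Nat. \<^bold>\<forall>\<^sub>\<star>''X'':KArrow Nat Star.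
     TV ''X'' $$ zero \<^bold>\<rightarrow>
     (\<^bold>\<forall>''n'':Nat. TV ''A'' \<^bold>\<rightarrow> TV ''X'' $$ V ''n'' \<^bold>\<rightarrow> TV ''X'' $$ (suc $ V ''n'')) \<^bold>\<rightarrow>
     TV ''X'' $$ V ''n''"

definition nilCV :: trm where
  "nilCV = \<^bold>\<Lambda>\<^sub>\<star>''A''. \<^bold>\<Lambda>\<^sub>\<star>''X''. \<^bold>\<lambda>''cN''. \<^bold>\<lambda>''cC''. V ''cN''"

definition consCV :: trm where
  "consCV = \<^bold>\<Lambda>\<^sub>\<star>''A''. \<^bold>\<Lambda>''n''. \<^bold>\<lambda>''x''. \<^bold>\<lambda>''xs''. \<^bold>\<Lambda>\<^sub>\<star>''X''. \<^bold>\<lambda>''cN''. \<^bold>\<lambda>''cC''.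
     V ''cC'' $- V ''n'' $ V ''x'' $ (V ''xs'' \<cdot> TV ''X'' $ V ''cN'' $ V ''cC'')"

definition VecP :: ty where
  "VecP = \<^bold>\<lambda>\<^sub>\<star>''A'':Star. \<^bold>\<lambda>''n'':Nat. \<^bold>\<lambda>''xsC'':VecC \<cdot>\<cdot> TV ''A'' $$ V ''n''.
     \<^bold>\<forall>\<^sub>\<star>''X'':KArrow Nat Star. \<^bold>\<forall>\<^sub>\<star>''P'':KPi ''n'' Nat (KArrow (TV ''X'' $$ V ''n'') Star).
     \<^bold>\<forall>''cN'':TV ''X'' $$ zero.
     \<^bold>\<forall>''cC'':(\<^bold>\<forall>''n'':Nat. TV ''A'' \<^bold>\<rightarrow> TV ''X'' $$ V ''n'' \<^bold>\<rightarrow> TV ''X'' $$ (suc $ V ''n'')).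
       TV ''P'' $$ zero $$ V ''cN'' \<^bold>\<rightarrow>
       (\<^bold>\<forall>''n'':Nat. \<^bold>\<forall>''xs'':TV ''X'' $$ V ''n''. \<^bold>\<Pi>''x'':TV ''A''.
          TV ''P'' $$ V ''n'' $$ V ''xs'' \<^bold>\<rightarrow>
          TV ''P'' $$ (suc $ V ''n'') $$ (V ''cC'' $- V ''n'' $ V ''x'' $ V ''xs'')) \<^bold>\<rightarrow>
       TV ''P'' $$ V ''n'' $$ (V ''xsC'' \<cdot> TV ''X'' $ V ''cN'' $ V ''cC'')"

definition VecR :: ty where
  "VecR = \<^bold>\<lambda>\<^sub>\<star>''A'':Star. \<^bold>\<lambda>''n'':Nat. \<^bold>\<lambda>''xsC'':VecC \<cdot>\<cdot> TV ''A'' $$ V ''n''.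
     (V ''xsC'' \<cdot> (VecC \<cdot>\<cdot> TV ''A'') $ nilCV $ consCV \<simeq> V ''xsC'')"

definition Vec :: ty where
  "Vec = \<^bold>\<lambda>\<^sub>\<star>''A'':Star. \<^bold>\<lambda>''n'':Nat.
     \<^bold>\<iota>''xs'':(\<^bold>\<iota>''xsC'':VecC \<cdot>\<cdot> TV ''A'' $$ V ''n''. VecP \<cdot>\<cdot> TV ''A'' $$ V ''n'' $$ V ''xsC'').
       VecR \<cdot>\<cdot> TV ''A'' $$ V ''n'' $$ Fst (V ''xs'')"

definition mkVec :: trm where
  "mkVec = \<^bold>\<Lambda>\<^sub>\<star>''A''. \<^bold>\<Lambda>''n''. \<^bold>\<lambda>''xs''. \<^bold>\<Lambda>''q''. Pair (V ''xs'') (\<rho> (V ''q'') - BetaT (V ''xs''))"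


section \<open>Coercions between vectors and lists\<close>

definition v2lC :: trm where
  "v2lC = \<^bold>\<Lambda>\<^sub>\<star>''A''. \<^bold>\<Lambda>''n''. \<^bold>\<lambda>''xs''. \<^bold>\<Lambda>\<^sub>\<star>''X''. \<^bold>\<lambda>''cN''. \<^bold>\<lambda>''cC''.
     Fst (Fst (V ''xs'')) \<cdot> (\<^bold>\<lambda>''_'':Nat. TV ''X'') $ V ''cN'' $ (\<^bold>\<Lambda>''_''. V ''cC'')"

definition v2lP :: trm where
  "v2lP = \<^bold>\<Lambda>\<^sub>\<star>''A''. \<^bold>\<Lambda>''n''. \<^bold>\<lambda>''xs''. \<^bold>\<Lambda>\<^sub>\<star>''X''. \<^bold>\<Lambda>\<^sub>\<star>''P''. \<^bold>\<Lambda>''cN''. \<^bold>\<Lambda>''cC''. \<^bold>\<lambda>''pN''. \<^bold>\<lambda>''pC''.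
     Snd (Fst (V ''xs'')) \<cdot> (\<^bold>\<lambda>''_'':Nat. TV ''X'') \<cdot> (\<^bold>\<lambda>''_'':Nat. TV ''P'')
       $- V ''cN'' $- (\<^bold>\<Lambda>''_''. V ''cC'') $ V ''pN'' $ (\<^bold>\<Lambda>''_''. V ''pC'')"

definition v2lR :: trm where
  "v2lR = \<^bold>\<Lambda>\<^sub>\<star>''A''. \<^bold>\<Lambda>''n''. \<^bold>\<lambda>''xs''. Snd (V ''xs'')"

definition v2l :: trm where
  "v2l = \<^bold>\<Lambda>\<^sub>\<star>''A''. \<^bold>\<Lambda>''n''. \<^bold>\<lambda>''xs''.
     mkList \<cdot> TV ''A''
       $ Pair (v2lC \<cdot> TV ''A'' $- V ''n'' $ V ''xs'') (v2lP \<cdot> TV ''A'' $- V ''n'' $ V ''xs'')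
       $- (v2lR \<cdot> TV ''A'' $- V ''n'' $ V ''xs'')"

definition l2vC :: trm where
  "l2vC = \<^bold>\<Lambda>\<^sub>\<star>''A''. \<^bold>\<lambda>''xs''. \<^bold>\<Lambda>\<^sub>\<star>''X''. \<^bold>\<lambda>''cN''. \<^bold>\<lambda>''cC''.
     elimList \<cdot> TV ''A'' $ V ''xs''
       \<cdot> (\<^bold>\<lambda>''xs'':List \<cdot>\<cdot> TV ''A''. TV ''X'' $$ (lengthL \<cdot> TV ''A'' $ V ''xs''))
       $ V ''cN'' $ (\<^bold>\<Lambda>''xs''. V ''cC'' $- (lengthL \<cdot> TV ''A'' $ V ''xs''))"

definition l2vP :: trm where
  "l2vP = \<^bold>\<Lambda>\<^sub>\<star>''A''. \<^bold>\<lambda>''xs''. \<^bold>\<Lambda>\<^sub>\<star>''X''. \<^bold>\<Lambda>\<^sub>\<star>''P''. \<^bold>\<Lambda>''cN''. \<^bold>\<Lambda>''cC''. \<^bold>\<lambda>''pN''. \<^bold>\<lambda>''pC''.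
     elimList \<cdot> TV ''A'' $ V ''xs''
       \<cdot> (\<^bold>\<lambda>''xs'':List \<cdot>\<cdot> TV ''A''. TV ''P'' $$ (lengthL \<cdot> TV ''A'' $ V ''xs'')
            $$ (l2vC \<cdot> TV ''A'' $ V ''xs'' \<cdot> TV ''X'' $ V ''cN'' $ V ''cC''))
       $ V ''pN''
       $ (\<^bold>\<Lambda>''xs''. V ''pC'' $- (lengthL \<cdot> TV ''A'' $ V ''xs'')
            $- (l2vC \<cdot> TV ''A'' $ V ''xs'' \<cdot> TV ''X'' $ V ''cN'' $ V ''cC''))"

definition l2vR :: trm where
  "l2vR = \<^bold>\<Lambda>\<^sub>\<star>''A''. \<^bold>\<lambda>''xs''. Snd (V ''xs'')"

definition l2v :: trm where
  "l2v = \<^bold>\<Lambda>\<^sub>\<star>''A''. \<^bold>\<lambda>''xs''.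
     mkVec \<cdot> TV ''A'' $- (lengthL \<cdot> TV ''A'' $ V ''xs'')
       $ Pair (l2vC \<cdot> TV ''A'' $ V ''xs'') (l2vP \<cdot> TV ''A'' $ V ''xs'')
       $- (l2vR \<cdot> TV ''A'' $ V ''xs'')"


section \<open>Length-constrained lists and append\<close>

definition VecL :: ty where
  "VecL = \<^bold>\<lambda>\<^sub>\<star>''A'':Star. \<^bold>\<lambda>''n'':Nat.
     \<^bold>\<iota>''xs'':List \<cdot>\<cdot> TV ''A''. (V ''n'' \<simeq> lengthL \<cdot> TV ''A'' $ V ''xs'')"

definition mkVecL :: trm where
  "mkVecL = \<^bold>\<Lambda>\<^sub>\<star>''A''. \<^bold>\<Lambda>''n''. \<^bold>\<lambda>''xs''. \<^bold>\<Lambda>''q''. Pair (V ''xs'') (\<rho> (V ''q'') - BetaT (V ''xs''))"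

definition lengthPres_type :: ty where
  "lengthPres_type = \<^bold>\<forall>\<^sub>\<star>''A'':Star. \<^bold>\<forall>''n'':Nat. \<^bold>\<Pi>''xs'':Vec \<cdot>\<cdot> TV ''A'' $$ V ''n''.
     (V ''n'' \<simeq> lengthL \<cdot> TV ''A'' $ (v2l \<cdot> TV ''A'' $- V ''n'' $ V ''xs''))"

definition v2u :: "trm \<Rightarrow> trm" where
  "v2u lengthPres = \<^bold>\<Lambda>\<^sub>\<star>''A''. \<^bold>\<Lambda>''n''. \<^bold>\<lambda>''xs''.
     mkVecL \<cdot> TV ''A'' $- V ''n'' $ (v2l \<cdot> TV ''A'' $- V ''n'' $ V ''xs'')
       $- Sym (lengthPres \<cdot> TV ''A'' $- V ''n'' $ V ''xs'')"

definition appendL_type :: ty where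
  "appendL_type = \<^bold>\<forall>\<^sub>\<star>''A'':Star. List \<cdot>\<cdot> TV ''A'' \<^bold>\<rightarrow> List \<cdot>\<cdot> TV ''A'' \<^bold>\<rightarrow> List \<cdot>\<cdot> TV ''A''"

definition lengthDistAppend_type :: "trm \<Rightarrow> ty" where
  "lengthDistAppend_type appendL =
     \<^bold>\<forall>\<^sub>\<star>''A'':Star. \<^bold>\<Pi>''xs'':List \<cdot>\<cdot> TV ''A''. \<^bold>\<Pi>''ys'':List \<cdot>\<cdot> TV ''A''.
       (add $ (lengthL \<cdot> TV ''A'' $ V ''xs'') $ (lengthL \<cdot> TV ''A'' $ V ''ys'')
          \<simeq> lengthL \<cdot> TV ''A'' $ (appendL \<cdot> TV ''A'' $ V ''xs'' $ V ''ys''))"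

definition appendV :: "trm \<Rightarrow> trm \<Rightarrow> trm \<Rightarrow> trm" where
  "appendV lengthPres appendL lengthDistAppend =
     (let vxs = v2u lengthPres \<cdot> TV ''A'' $- V ''n'' $ V ''xs'';
          vys = v2u lengthPres \<cdot> TV ''A'' $- V ''m'' $ V ''ys''
      in \<^bold>\<Lambda>\<^sub>\<star>''A''. \<^bold>\<Lambda>''n''. \<^bold>\<lambda>''xs''. \<^bold>\<Lambda>''m''. \<^bold>\<lambda>''ys''.
           \<rho> (Snd vxs) - \<rho> (Snd vys) -
           \<rho> (lengthDistAppend \<cdot> TV ''A'' $ Fst vxs $ Fst vys) -
           (l2v \<cdot> TV ''A'' $ (appendL \<cdot> TV ''A'' $ Fst vxs $ Fst vys)))"

end

theory Submission
  imports Defs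
begin

text \<open>
  The coercions \<open>v2u\<close> and \<open>l2v\<close> erase to \<open>\<eta>\<close>-expanded identities, so
  \<open>appendV\<close> erases to \<open>\<lambda>xs ys. M xs ys\<close> with \<open>M = erase appendL\<close>, which
  \<open>\<eta>\<close>-contracts to \<open>M\<close> if \<open>M\<close> is closed.  Closedness of \<open>appendL\<close> is not enough for
  this, because erasing \<open>\<^bold>\<Lambda>x. t\<close> removes a binder; it is typability that bounds the free
  variables of the erasure by the context.
\<close>

text \<open>Replacing a variable by a name outside this set never forces a change of the bound names
  that matter to the erasure. Erased abstractions over values count too, since substitution still
  passes under them.\<close>

primrec computational_binders :: "trm \<Rightarrow> name set" where
  "computational_binders (V x) = {}"
| "computational_binders (Lam x t) = insert x (computational_binders t)"
| "computational_binders (ILam x t) = insert x (computational_binders t)"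
| "computational_binders (TLam X t) = computational_binders t"
| "computational_binders (App t t') = computational_binders t \<union> computational_binders t'"
| "computational_binders (IApp t t') = computational_binders t"
| "computational_binders (TApp t T) = computational_binders t"
| "computational_binders (Pair t t') = computational_binders t"
| "computational_binders (Fst t) = computational_binders t"
| "computational_binders (Snd t) = computational_binders t"
| "computational_binders Beta = {}"
| "computational_binders (BetaT t) = computational_binders t"
| "computational_binders (Rho q t) = computational_binders t"
| "computational_binders (Sym q) = computational_binders q"

lemma finite_computational_binders: "finite (computational_binders t)"
  by (induction t rule: trm.induct[of _ "\<lambda>_. True" "\<lambda>_. True"]) auto

text \<open>An invariant for induction on terms: \<open>\<sigma>\<close> stops renaming below a
  binder of \<open>x\<close>, and \<open>\<tau>\<close> may rename type binders freely because it
  introduces no term variables.\<close>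

definition renames_at_most :: "name \<Rightarrow> name \<Rightarrow> (name \<Rightarrow> trm) \<Rightarrow> (name \<Rightarrow> ty) \<Rightarrow> bool" where
  "renames_at_most x z \<sigma> \<tau> \<longleftrightarrow>
     (\<forall>y. \<sigma> y = V y \<or> y = x \<and> \<sigma> y = V z) \<and> (\<forall>X y. TmV y \<notin> fv_ty (\<tau> X))"

lemma renames_at_most_upd:
  assumes "renames_at_most x z \<sigma> \<tau>"
  shows "renames_at_most x z (\<sigma>(y := V y)) \<tau>" "renames_at_most x z \<sigma> (\<tau>(X := TV Y))"
  using assms by (auto simp: renames_at_most_def)

lemma new_tm_id:
  assumes \<sigma>\<tau>: "renames_at_most x z \<sigma> \<tau>" and "y \<noteq> z"
  shows "new_tm \<sigma> \<tau> y S = y"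
proof -
  have "TmV y \<notin> (case v of TmV w \<Rightarrow> fv_trm (\<sigma> w) | TyV X \<Rightarrow> fv_ty (\<tau> X))"
    if "v \<in> S - {TmV y}" for v
  proof (cases v)
    case (TmV w)
    have "\<sigma> w = V w \<or> \<sigma> w = V z" using \<sigma>\<tau> by (auto simp: renames_at_most_def)
    then show ?thesis using that TmV \<open>y \<noteq> z\<close> by auto
  next
    case (TyV X)
    then show ?thesis using \<sigma>\<tau> by (simp add: renames_at_most_def)
  qed
  then show ?thesis by (auto simp: new_tm_def pick_def image_fv_def)
qed

text \<open>
  The first disjunct is needed also for \<open>y = x\<close>: an occurrence of \<open>x\<close> bound by an
  erased abstraction is free in the erasure but untouched by the substitution.
\<close>

lemma lfv_erase_rename:
  assumes "renames_at_most x z \<sigma> \<tau>" "z \<notin> computational_binders t" "y \<in> lfv (erase t)"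
  shows "y \<in> lfv (erase (sub_trm \<sigma> \<tau> t)) \<or> y = x \<and> z \<in> lfv (erase (sub_trm \<sigma> \<tau> t))"
  using assms
proof (induction t arbitrary: \<sigma> \<tau> rule: trm.induct[of _ "\<lambda>_. True" "\<lambda>_. True"])
  case (V x')
  have "\<sigma> x' = V x' \<or> x' = x \<and> \<sigma> x' = V z"
    using V.prems(1) by (simp add: renames_at_most_def)
  then show ?case using V.prems(3) by auto
next
  case (Lam x' t)
  have "new_tm \<sigma> \<tau> x' (fv_trm t) = x'"
    using Lam.prems(2) by (intro new_tm_id[OF Lam.prems(1)]) auto
  moreover have "y \<in> lfv (erase (sub_trm (\<sigma>(x' := V x')) \<tau> t)) \<or>
      y = x \<and> z \<in> lfv (erase (sub_trm (\<sigma>(x' := V x')) \<tau> t))"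
    using Lam.prems by (intro Lam.IH renames_at_most_upd) auto
  ultimately show ?case
    using Lam.prems(2,3) by (auto simp: Let_def)
next
  case (ILam x' t)
  have "new_tm \<sigma> \<tau> x' (fv_trm t) = x'"
    using ILam.prems(2) by (intro new_tm_id[OF ILam.prems(1)]) auto
  moreover have "y \<in> lfv (erase (sub_trm (\<sigma>(x' := V x')) \<tau> t)) \<or>
      y = x \<and> z \<in> lfv (erase (sub_trm (\<sigma>(x' := V x')) \<tau> t))"
    using ILam.prems by (intro ILam.IH renames_at_most_upd) auto
  ultimately show ?case
    using ILam.prems(2,3) by (auto simp: Let_def)
next
  case (TLam X t)
  let ?Z = "new_ty \<sigma> \<tau> X (fv_trm t)"
  have "y \<in> lfv (erase (sub_trm \<sigma> (\<tau>(X := TV ?Z)) t)) \<or>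
      y = x \<and> z \<in> lfv (erase (sub_trm \<sigma> (\<tau>(X := TV ?Z)) t))"
    using TLam.prems by (intro TLam.IH renames_at_most_upd) auto
  then show ?case by (simp add: Let_def)
next
  case (App t t')
  then show ?case using App.IH[OF App.prems(1)] by auto
qed simp_all

lemma finite_lfv: "finite (lfv M)"
  by (induction M) auto

lemma fresh_name:
  assumes "finite (A :: name set)"
  obtains z where "z \<notin> A"
  using ex_new_if_finite[OF infinite_UNIV_listI assms] by blast

lemma lfv_erase_rename_tm:
  assumes "z \<notin> computational_binders t" "y \<in> lfv (erase t)"
  shows "y \<in> lfv (erase (t[x ::= V z]\<^sub>t)) \<or> y = x \<and> z \<in> lfv (erase (t[x ::= V z]\<^sub>t))"
  using assms by (intro lfv_erase_rename) (auto simp: renames_at_most_def)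

lemma lfv_erase_rename_ty:
  assumes "y \<in> lfv (erase t)"
  shows "y \<in> lfv (erase (t[X ::= TV Z]\<^sub>t\<^sub>T))"
proof -
  have "finite (insert y (computational_binders t))" using finite_computational_binders by simp
  then obtain z where z: "z \<notin> insert y (computational_binders t)" by (rule fresh_name)
  \<comment> \<open>The identity on term variables counts as renaming a fresh \<open>z\<close> to
    itself.\<close>
  have "renames_at_most z z V (TV(X := TV Z))" by (simp add: renames_at_most_def)
  from lfv_erase_rename[OF this _ assms] show ?thesis using z by auto
qed

text \<open>Induction on typing alone suffices, as types vanish under erasure. At binders, the
  cofinite premise is used at a fresh name and the renaming lemmas carry the bound back to the
  unopened body.\<close>

lemma lfv_erase_typing:
  "\<Gamma> \<turnstile> t : T \<Longrightarrow> TmV ` lfv (erase t) \<subseteq> decl_var ` set \<Gamma>"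
proof (induction rule: kind_ok_kinding_typing.inducts(3)[of _ _ _ "\<lambda>_ _. True" "\<lambda>_ _ _. True"])
  case (t_var x T \<Gamma>)
  then show ?case by force
next
  case (t_Lam \<Gamma> T L t x T' y)
  have "finite (L \<union> computational_binders t \<union> lfv (erase t))"
    using t_Lam.hyps(3) finite_computational_binders finite_lfv by simp
  then obtain z where z: "z \<notin> L" "z \<notin> computational_binders t" "z \<notin> lfv (erase t)"
    by (rule fresh_name) blast
  have *: "TmV ` lfv (erase (t[x ::= V z]\<^sub>t)) \<subseteq> insert (TmV z) (decl_var ` set \<Gamma>)"
    using t_Lam.IH[OF z(1)] by simp
  have "TmV v \<in> decl_var ` set \<Gamma>" if v: "v \<in> lfv (erase t)" "v \<noteq> x" for v
  proof -
    have "v \<in> lfv (erase (t[x ::= V z]\<^sub>t))"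
      using lfv_erase_rename_tm[OF z(2) v(1)] v(2) by blast
    moreover have "v \<noteq> z" using v(1) z(3) by blast
    ultimately show ?thesis using * by blast
  qed
  then show ?case by auto
next
  case (t_ILam \<Gamma> T L t x T' y)
  have "finite (L \<union> computational_binders t)"
    using t_ILam.hyps(3) finite_computational_binders by simp
  then obtain z where z: "z \<notin> L" "z \<notin> computational_binders t"
    by (rule fresh_name) blast
  have *: "TmV ` lfv (erase (t[x ::= V z]\<^sub>t)) \<subseteq> insert (TmV z) (decl_var ` set \<Gamma>)"
    using t_ILam.IH[OF z(1)] by simp
  \<comment> \<open>The side condition on erased abstraction excludes the second disjunct of the
    renaming lemma, so every free name of the erased body, even \<open>x\<close>, survives the
    renaming and differs from \<open>z\<close>.\<close>
  have **: "z \<notin> lfv (erase (t[x ::= V z]\<^sub>t))"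
    using t_ILam.hyps z(1) by blast
  have "TmV v \<in> decl_var ` set \<Gamma>" if v: "v \<in> lfv (erase t)" for v
  proof -
    have "v \<in> lfv (erase (t[x ::= V z]\<^sub>t))"
      using lfv_erase_rename_tm[OF z(2) v] ** by blast
    moreover from this ** have "v \<noteq> z" by blast
    ultimately show ?thesis using * by blast
  qed
  then show ?case by auto
next
  case (t_TLam \<Gamma> K L t X T Y)
  obtain Z where "Z \<notin> L" using t_TLam.hyps(3) by (rule fresh_name)
  then have "TmV ` lfv (erase (t[X ::= TV Z]\<^sub>t\<^sub>T)) \<subseteq> insert (TyV Z) (decl_var ` set \<Gamma>)"
    using t_TLam.IH[of Z] by simp
  then show ?case using lfv_erase_rename_ty[of _ t X Z] by auto
next
  \<comment> \<open>The term \<open>t'\<close> need not be typable; its bound is the second conjunct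
    of \<open>scoped\<close>.\<close>
  case (t_BetaT \<Gamma> t t')
  then show ?case by (simp add: scoped_def)
qed (simp_all add: image_Un)

text \<open>The bound name is the one used in the coercions, so \<open>abe_lam\<close> applies to
  them without renaming.\<close>

abbreviation idL :: lam where "idL \<equiv> LLam ''xs'' (LVar ''xs'')"

lemma abe_idL: "LApp idL N =\<^sub>\<alpha>\<^sub>\<beta>\<^sub>\<eta> N"
  using beta[of "''xs''" "LVar ''xs''" N] by simp

lemma abe_app_id: "M =\<^sub>\<alpha>\<^sub>\<beta>\<^sub>\<eta> idL \<Longrightarrow> N =\<^sub>\<alpha>\<^sub>\<beta>\<^sub>\<eta> N' \<Longrightarrow> LApp M N =\<^sub>\<alpha>\<^sub>\<beta>\<^sub>\<eta> N'"
  by (meson abe_app abe_idL abe_trans)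

text \<open>Eta is applied to the inner binder first. Requiring only convertibility of
  \<open>N\<close> lets coercions inside the body be cancelled beforehand.\<close>

lemma abe_eta2:
  assumes "N =\<^sub>\<alpha>\<^sub>\<beta>\<^sub>\<eta> LApp (LApp M (LVar x)) (LVar y)" "x \<notin> lfv M" "y \<notin> lfv M" "x \<noteq> y"
  shows "LLam x (LLam y N) =\<^sub>\<alpha>\<^sub>\<beta>\<^sub>\<eta> M"
proof -
  note [trans] = abe_trans
  have "LLam y N =\<^sub>\<alpha>\<^sub>\<beta>\<^sub>\<eta> LLam y (LApp (LApp M (LVar x)) (LVar y))"
    using assms(1) by (rule abe_lam)
  also have "\<dots> =\<^sub>\<alpha>\<^sub>\<beta>\<^sub>\<eta> LApp M (LVar x)"
    using assms by (intro eta) auto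
  finally have "LLam x (LLam y N) =\<^sub>\<alpha>\<^sub>\<beta>\<^sub>\<eta> LLam x (LApp M (LVar x))"
    by (rule abe_lam)
  then show ?thesis using eta[OF assms(2)] by (rule abe_trans)
qed

lemma erase_elimList: "erase elimList = idL"
  by (simp add: elimList_def)

lemma erase_v2lC: "erase v2lC =\<^sub>\<alpha>\<^sub>\<beta>\<^sub>\<eta> idL"
  unfolding v2lC_def erase.simps by (rule abe_lam, rule abe_eta2, rule abe_refl) simp_all

lemma erase_l2vC: "erase l2vC =\<^sub>\<alpha>\<^sub>\<beta>\<^sub>\<eta> idL"
  unfolding l2vC_def erase.simps erase_elimList
  by (rule abe_lam, rule abe_eta2, rule abe_app, rule abe_app, rule abe_idL, (rule abe_refl)+)
    simp_all

text \<open>\<open>mkList\<close> erases to \<open>idL\<close> itself and a pair to its first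
  component, so only \<open>v2lC\<close> remains.\<close>

lemma erase_v2l: "erase v2l =\<^sub>\<alpha>\<^sub>\<beta>\<^sub>\<eta> idL"
  unfolding v2l_def mkList_def erase.simps
  by (intro abe_lam abe_app_id[OF abe_refl] abe_app_id[OF erase_v2lC] abe_refl)

lemma erase_l2v: "erase l2v =\<^sub>\<alpha>\<^sub>\<beta>\<^sub>\<eta> idL"
  unfolding l2v_def mkVec_def erase.simps
  by (intro abe_lam abe_app_id[OF abe_refl] abe_app_id[OF erase_l2vC] abe_refl)

text \<open>The length proof is passed as an implicit argument and disappears.\<close>

lemma erase_v2u: "erase (v2u p) =\<^sub>\<alpha>\<^sub>\<beta>\<^sub>\<eta> idL"
  unfolding v2u_def mkVecL_def erase.simps
  by (intro abe_lam abe_app_id[OF abe_refl] abe_app_id[OF erase_v2l] abe_refl)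

theorem theorem4p3:
  fixes lengthPres appendL lengthDistAppend :: trm
  assumes "[] \<turnstile> lengthPres : lengthPres_type"
    and "fv_trm appendL = {}"
    and "[] \<turnstile> appendL : appendL_type"
    and "[] \<turnstile> lengthDistAppend : lengthDistAppend_type appendL"
  shows "erase (appendV lengthPres appendL lengthDistAppend) =\<^sub>\<alpha>\<^sub>\<beta>\<^sub>\<eta> erase appendL"
proof -
  \<comment> \<open>The empty context leaves no free names, which yields the freshness conditions of
    \<open>abe_eta2\<close>.\<close>
  have "lfv (erase appendL) = {}"
    using lfv_erase_typing[OF assms(3)] by simp
  then show ?thesis
    unfolding appendV_def Let_def erase.simps
    by (intro abe_eta2 abe_app_id[OF erase_l2v] abe_app abe_app_id[OF erase_v2u] abe_refl) simp_all
qed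

end
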